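(* Let $p>1$, let $f\in C^1([0,\infty))$ be real-valued, and suppose that for some $\gamma>0$ the following hold: (i) $f(\gamma)=0$ and $f(u)>0$ for all $u\in(\gamma,\infty)$; (ii) $f'(u)>(p-1)\dfrac{f(u)}{u}$ for all $u>\gamma$; (iii) $\displaystyle\int_u^{\gamma} f(t)\,dt<0$ for all $u\in(0,\gamma)$. Let $u$ be any positive solution of $$\varphi(u'(x))'+f(u(x))=0\quad\text{for } -1<x<1,\qquad u(-1)=u(1)=0,$$ where $\varphi(t)=t|t|^{p-2}$, satisfying $u(0)>\gamma$ and $u'(1)<0$. Then $u$ is non-singular, i.e. the linearized problem $$\left(\varphi'(u'(x))\,w'(x)\right)'+f'(u(x))\,w(x)=0\quad\text{for } -1<x<1,\qquad w(-1)=w(1)=0,$$ admits only the trivial solution $w\equiv 0$.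
   Context: Here $\varphi(t)=t|t|^{p-2}$ with $p>1$, so that $\varphi'(t)=(p-1)|t|^{p-2}$. A positive solution is a solution $u$ with $u(x)>0$ for all $x\in(-1,1)$. A positive solution $u$ of the boundary value problem is called non-singular if the linearized problem at $u$ (as displayed in the claim) has only the trivial solution $w(x)\equiv 0$.
   Formalization: For p>2 it is also assumed that no x in (-1,1) has u'(x)=0 and f(u(x))=0 (the claim can fail otherwise); w is continuous, differentiable where u'≠0, and φ'(u')w' extends to a differentiable function on (-1,1). *)

theory Defs
  imports "HOL-Analysis.Analysis"
begin

definition phi :: "real \<Rightarrow> real \<Rightarrow> real" where
  "phi p t = t * \<bar>t\<bar> powr (p - 2)"

(* To be used at t \<noteq> 0 only: 0 powr a = 0 for every a, which is not the derivative of phi at 0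
   when p = 2 (it is 1 there) or p < 2 (it is infinite there). *)
definition phi_deriv :: "real \<Rightarrow> real \<Rightarrow> real" where
  "phi_deriv p t = (p - 1) * \<bar>t\<bar> powr (p - 2)"

(* u' is the derivative of u on [-1,1], one-sided at the end points.  Solutions are C^1 functions
   with differentiable phi(u'); they need not be C^2 where u' = 0.  Continuity of u' up to the
   boundary follows from the equation when f is continuous. *)
definition positive_solution ::
  "real \<Rightarrow> (real \<Rightarrow> real) \<Rightarrow> (real \<Rightarrow> real) \<Rightarrow> (real \<Rightarrow> real) \<Rightarrow> bool" where
  "positive_solution p f u u' \<longleftrightarrow>
     (\<forall>x\<in>{-1..1}. (u has_real_derivative u' x) (at x within {-1..1})) \<and>
     (\<forall>x\<in>{-1<..<1}. ((\<lambda>y. phi p (u' y)) has_real_derivative - f (u x)) (at x)) \<and>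
     u (-1) = 0 \<and> u 1 = 0 \<and>
     (\<forall>x\<in>{-1<..<1}. u x > 0)"

(* z is the flux phi'(u') w'.  Where u' = 0 the coefficient phi'(u') vanishes (p > 2) or is
   infinite (p < 2), and the product is understood as the continuous extension z.  There w is only
   required to be continuous: for p > 2 solutions of the linearized equation can have infinite
   slope at such a point, as w = u' does at the maximum of u.  For p = 2 and isolated zeros of u'
   this is the classical notion, since then w' = z everywhere. *)
definition linearized_solution ::
  "real \<Rightarrow> (real \<Rightarrow> real) \<Rightarrow> (real \<Rightarrow> real) \<Rightarrow> (real \<Rightarrow> real) \<Rightarrow> (real \<Rightarrow> real) \<Rightarrow> bool" where
  "linearized_solution p f' u u' w \<longleftrightarrow>
     continuous_on {-1..1} w \<and> w (-1) = 0 \<and> w 1 = 0 \<and>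
     (\<exists>w' z.
        (\<forall>x\<in>{-1<..<1}. u' x \<noteq> 0 \<longrightarrow>
            (w has_real_derivative w' x) (at x) \<and> z x = phi_deriv p (u' x) * w' x) \<and>
        (\<forall>x\<in>{-1<..<1}. (z has_real_derivative - (f' (u x) * w x)) (at x)))"

(* A positive solution can have u'(x) = 0 and f(u(x)) = 0 at the same x only if p > 2, when
   initial value problems at such a rest point need not be uniquely solvable.  u may then stay at
   that level on an interval of any length, and if also f'(u(x)) = 0 every smooth w supported in
   the interval satisfies the linearized problem.  Statements about non-singularity
   have to exclude this case explicitly. *)
definition non_singular ::
  "real \<Rightarrow> (real \<Rightarrow> real) \<Rightarrow> (real \<Rightarrow> real) \<Rightarrow> (real \<Rightarrow> real) \<Rightarrow> bool" where
  "non_singular p f' u u' \<longleftrightarrow>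
     (\<forall>w. linearized_solution p f' u u' w \<longrightarrow> (\<forall>x\<in>{-1..1}. w x = 0))"

end

theory Submission
  imports Defs
begin

text \<open>
  Conservation of \<open>\<bar>u'\<bar>\<^sup>p + q F(u)\<close>, where \<open>F\<close> is the primitive of \<open>f\<close> and \<open>q = p / (p - 1)\<close>,
  shows that the maximum point \<open>x\<^sub>0\<close> is the only critical point of \<open>u\<close>, and that \<open>\<bar>u'\<bar>\<close> on the set
  where \<open>u < \<gamma>\<close> is smaller than at the points with \<open>u = \<gamma>\<close>, because \<open>F\<close> has its minimum over
  \<open>(0, \<gamma>]\<close> at \<open>\<gamma>\<close>.

  Let \<open>w\<close> solve the linearized problem with flux \<open>z\<close>. As \<open>u'\<close> is another solution, with flux
  \<open>- f(u)\<close>, the Wronskian \<open>k = w f(u) + u' z\<close> is constant and \<open>(w / u')' = k / ((p - 1) \<bar>u'\<bar>\<^sup>p)\<close>.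
  If \<open>k = 0\<close>, then \<open>w / u'\<close> is constant on either side of \<open>x\<^sub>0\<close> and vanishes at the end point, so
  \<open>w = 0\<close>. Otherwise let \<open>k > 0\<close>, so that \<open>w > 0\<close>. The function
  \<open>T = u z - (p - 1) \<phi>(u') w\<close> satisfies \<open>T' = - (f'(u) u - (p - 1) f(u)) w\<close>, so it decreases
  between the two points \<open>\<eta> < \<xi>\<close> with \<open>u = \<gamma>\<close>. At these points \<open>u' z = k\<close>, and comparing
  \<open>w / u'\<close> on \<open>(\<xi>, 1)\<close> with a multiple of \<open>u\<close> gives \<open>T(\<xi>) > 0\<close>; by reflection
  \<open>T(\<eta>) < 0\<close>, a contradiction.
\<close>

subsection \<open>The function \<open>\<phi>\<close> and one-variable calculus\<close>

definition phi_inv :: "real \<Rightarrow> real \<Rightarrow> real" where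
  "phi_inv p s = sgn s * \<bar>s\<bar> powr (1 / (p - 1))"

lemma abs_phi: "\<bar>phi p t\<bar> = \<bar>t\<bar> powr (p - 1)"
proof (cases "t = 0")
  case False
  then have "\<bar>t\<bar> * \<bar>t\<bar> powr (p - 2) = \<bar>t\<bar> powr (1 + (p - 2))"
    by (simp add: powr_mult_base)
  then show ?thesis by (simp add: phi_def abs_mult)
qed (simp add: phi_def)

lemma sgn_phi: "sgn (phi p t) = sgn t"
  by (cases "t = 0") (auto simp: phi_def sgn_mult)

lemma phi_inv_phi:
  assumes "p > 1"
  shows "phi_inv p (phi p t) = t"
proof -
  have "(\<bar>t\<bar> powr (p - 1)) powr (1 / (p - 1)) = \<bar>t\<bar>"
    using assms by (simp add: powr_powr)
  then show ?thesis
    unfolding phi_inv_def abs_phi sgn_phi by (simp add: sgn_mult_abs)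
qed

lemma phi_minus: "phi p (- t) = - phi p t"
  by (simp add: phi_def)

lemma phi_deriv_minus: "phi_deriv p (- t) = phi_deriv p t"
  by (simp add: phi_deriv_def)

lemma phi_deriv_mult_self: "phi_deriv p t * t = (p - 1) * phi p t"
  by (simp add: phi_deriv_def phi_def)

lemma phi_deriv_mult_square:
  "phi_deriv p t * t\<^sup>2 = (p - 1) * \<bar>t\<bar> powr p"
proof (cases "t = 0")
  case False
  have "\<bar>t\<bar> powr p = \<bar>t\<bar> powr (p - 2) * \<bar>t\<bar> powr 2"
    unfolding powr_add[symmetric] by simp
  then show ?thesis using False by (simp add: phi_deriv_def)
qed simp

lemma phi_deriv_pos: "p > 1 \<Longrightarrow> t \<noteq> 0 \<Longrightarrow> phi_deriv p t > 0"
  by (simp add: phi_deriv_def)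

lemma continuous_on_phi_inv:
  assumes "p > 1"
  shows "continuous_on UNIV (phi_inv p)"
proof -
  have "isCont (phi_inv p) s" for s
  proof (cases "s = 0")
    case True
    have "((\<lambda>s. \<bar>s\<bar> powr (1 / (p - 1))) \<longlongrightarrow> 0) (at (0::real))"
      using assms by (auto intro!: tendsto_eq_intros)
    moreover have "\<forall>\<^sub>F s in at 0. norm (phi_inv p s) \<le> \<bar>s\<bar> powr (1 / (p - 1))"
      by (auto simp: phi_inv_def abs_mult sgn_if)
    ultimately have "(phi_inv p \<longlongrightarrow> 0) (at 0)"
      by (rule Lim_null_comparison[rotated])
    then show ?thesis using True by (simp add: isCont_def phi_inv_def)
  next
    case False
    have "isCont (\<lambda>s. s * \<bar>s\<bar> powr (1 / (p - 1) - 1)) s"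
      using False by (intro continuous_intros) auto
    moreover have "phi_inv p = (\<lambda>s. s * \<bar>s\<bar> powr (1 / (p - 1) - 1))"
    proof
      fix r :: real
      show "phi_inv p r = r * \<bar>r\<bar> powr (1 / (p - 1) - 1)"
        by (cases "r = 0") (auto simp: phi_inv_def sgn_if powr_diff)
    qed
    ultimately show ?thesis by simp
  qed
  then show ?thesis by (simp add: continuous_on_eq_continuous_at)
qed

lemma has_real_derivative_phi:
  assumes "t \<noteq> 0"
  shows "(phi p has_real_derivative phi_deriv p t) (at t)"
proof -
  have e: "\<bar>t\<bar> powr (p - 2) = \<bar>t\<bar> powr (p - 3) * \<bar>t\<bar>"
    using assms powr_mult_base[of "\<bar>t\<bar>" "p - 3"] by (simp add: mult.commute)
  have "((\<lambda>t. t * \<bar>t\<bar> powr (p - 2)) has_real_derivative phi_deriv p t) (at t)"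
  proof (cases "t > 0")
    case True
    have "((\<lambda>t. t * t powr (p - 2)) has_real_derivative phi_deriv p t) (at t)"
      using True e by (auto intro!: derivative_eq_intros simp: phi_deriv_def algebra_simps)
    then show ?thesis
      by (rule has_field_derivative_transform_within_open[where S="{0<..}"]) (use True in auto)
  next
    case False
    then have neg: "t < 0" using assms by simp
    have "((\<lambda>t. t * (- t) powr (p - 2)) has_real_derivative phi_deriv p t) (at t)"
      using neg e by (auto intro!: derivative_eq_intros simp: phi_deriv_def algebra_simps)
    then show ?thesis
      by (rule has_field_derivative_transform_within_open[where S="{..<0}"]) (use neg in auto)
  qed
  then show ?thesis by (simp add: phi_def[abs_def])
qed

lemma phi_phi_inv:
  assumes "p > 1"
  shows "phi p (phi_inv p s) = s"
proof -
  have "\<bar>phi_inv p s\<bar> = \<bar>s\<bar> powr (1 / (p - 1))"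
    by (auto simp: phi_inv_def abs_mult sgn_if)
  then have "\<bar>phi p (phi_inv p s)\<bar> = \<bar>s\<bar>"
    using assms by (simp add: abs_phi powr_powr)
  moreover have "sgn (phi p (phi_inv p s)) = sgn s"
    by (cases "s = 0") (auto simp: sgn_phi phi_inv_def sgn_mult)
  ultimately show ?thesis by (metis sgn_mult_abs)
qed

text \<open>Transfers differentiability of the flux to \<open>u'\<close>. The point 0 is excluded:
  for p > 2 the inverse has infinite slope there.\<close>

lemma has_real_derivative_phi_inv:
  assumes "p > 1" "t \<noteq> 0"
  shows "(phi_inv p has_real_derivative inverse (phi_deriv p t)) (at (phi p t))"
proof (rule DERIV_inverse_function[where f="phi p" and a="phi p t - 1" and b="phi p t + 1"])
  show "(phi p has_real_derivative phi_deriv p t) (at (phi_inv p (phi p t)))"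
    using assms by (simp add: phi_inv_phi has_real_derivative_phi)
  show "phi_deriv p t \<noteq> 0"
    using phi_deriv_pos[OF assms] by simp
  show "isCont (phi_inv p) (phi p t)"
    using continuous_on_phi_inv[OF assms(1)] by (simp add: continuous_on_eq_continuous_at)
qed (use assms in \<open>auto simp: phi_phi_inv\<close>)

text \<open>The origin is included, where q > 1 makes the derivative 0: the energy is differentiated
  at critical points of \<open>u\<close> as well.\<close>

lemma has_real_derivative_abs_powr:
  fixes q s :: real
  assumes "q > 1"
  shows "((\<lambda>s. \<bar>s\<bar> powr q) has_real_derivative q * (sgn s * \<bar>s\<bar> powr (q - 1))) (at s)"
proof (cases s "0::real" rule: linorder_cases)
  case less
  have "((\<lambda>s. (- s) powr q) has_real_derivative q * (sgn s * \<bar>s\<bar> powr (q - 1))) (at s)"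
    using less by (auto intro!: derivative_eq_intros)
  then show ?thesis
    by (rule has_field_derivative_transform_within_open[where S="{..<0}"]) (use less in auto)
next
  case equal
  have "((\<lambda>h. \<bar>h\<bar> powr (q - 1)) \<longlongrightarrow> 0) (at (0::real))"
    using assms by (auto intro!: tendsto_eq_intros)
  moreover have "norm (\<bar>h\<bar> powr q / h) \<le> \<bar>h\<bar> powr (q - 1)" for h :: real
    by (cases "h = 0") (auto simp: powr_diff)
  then have "\<forall>\<^sub>F h in at 0. norm (\<bar>h\<bar> powr q / h) \<le> \<bar>h\<bar> powr (q - 1)"
    by (intro always_eventually allI)
  ultimately have "((\<lambda>h. \<bar>h\<bar> powr q / h) \<longlongrightarrow> 0) (at (0::real))"
    by (rule Lim_null_comparison[rotated])
  then show ?thesis using equal by (simp add: DERIV_def)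
next
  case greater
  have "((\<lambda>s. s powr q) has_real_derivative q * (sgn s * \<bar>s\<bar> powr (q - 1))) (at s)"
    using greater by (auto intro!: derivative_eq_intros)
  then show ?thesis
    by (rule has_field_derivative_transform_within_open[where S="{0<..}"]) (use greater in auto)
qed

section \<open>Primitives of \<open>f\<close> on the half line\<close>

definition primitive :: "(real \<Rightarrow> real) \<Rightarrow> real \<Rightarrow> real" where
  "primitive f v = integral {0..v} f"

lemma primitive_0 [simp]: "primitive f 0 = 0"
  by (simp add: primitive_def)

lemma primitive_derivative_within:
  assumes "continuous_on {0..} f" "v \<ge> 0"
  shows "(primitive f has_real_derivative f v) (at v within {0..})"
proof -
  have "continuous_on {0..v + 1} f"
    using assms(1) by (rule continuous_on_subset) auto
  then have "(primitive f has_real_derivative f v) (at v within {0..v + 1})"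
    unfolding primitive_def[abs_def] using assms(2) 
    by (intro integral_has_real_derivative) auto
  moreover have "at v within {0..v + 1} = at v within {0..}"
    by (rule at_within_nhd[where S="{..<v + 1}"]) auto
  ultimately show ?thesis by simp
qed

lemma primitive_derivative:
  assumes "continuous_on {0..} f" "v > 0"
  shows "(primitive f has_real_derivative f v) (at v)"
proof -
  have "at v within {0..} = at v"
    using assms(2) by (intro at_within_interior) auto
  then show ?thesis
    using primitive_derivative_within[of f v] assms by simp
qed

lemma continuous_on_primitive:
  "continuous_on {0..} f \<Longrightarrow> continuous_on {0..} (primitive f)"
  by (rule DERIV_continuous_on, rule primitive_derivative_within) auto

lemma integral_eq_primitive_diff:
  assumes "continuous_on {0..} f" "0 \<le> a" "a \<le> b"
  shows "integral {a..b} f = primitive f b - primitive f a"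
proof -
  have "f integrable_on {0..b}"
    using assms by (intro integrable_continuous_interval) (auto elim: continuous_on_subset)
  then show ?thesis
    using Henstock_Kurzweil_Integration.integral_combine[of 0 a b f] assms
    by (simp add: primitive_def)
qed

text \<open>Such a \<open>D\<close> is nondecreasing, so \<open>D x\<close> bounds the values near
  \<open>b\<close> and hence their limit from below. A left limit is used because \<open>D\<close>
  will involve \<open>w / u'\<close>, and continuity of \<open>u'\<close> at 1 is not
  assumed.\<close>

lemma tendsto_0_at_left_nonpos:
  fixes D :: "real \<Rightarrow> real"
  assumes lim: "(D \<longlongrightarrow> 0) (at_left b)" and "x < b"
    and cont: "continuous_on {x..<b} D"
    and deriv: "\<And>y. x < y \<Longrightarrow> y < b \<Longrightarrow> \<exists>d\<ge>0. (D has_real_derivative d) (at y)"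
  shows "D x \<le> 0"
proof -
  have "D x \<le> D y" if "x < y" "y < b" for y
  proof (rule DERIV_nonneg_imp_increasing_open[of x y D])
    show "continuous_on {x..y} D"
      using cont by (rule continuous_on_subset) (use that in auto)
    show "\<exists>d. (D has_real_derivative d) (at t) \<and> 0 \<le> d" if "x < t" "t < y" for t
      using deriv[of t] that \<open>y < b\<close> by force
  qed (use that in simp)
  then have "\<forall>\<^sub>F y in at_left b. D x \<le> D y"
    using \<open>x < b\<close> by (auto simp: eventually_at_left_field)
  then show ?thesis
    by (intro tendsto_lowerbound[OF lim]) simp_all
qed

lemma tendsto_0_at_left_neg:
  fixes D :: "real \<Rightarrow> real"
  assumes lim: "(D \<longlongrightarrow> 0) (at_left b)" and "x < b"
    and cont: "continuous_on {x..<b} D"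
    and deriv: "\<And>y. x < y \<Longrightarrow> y < b \<Longrightarrow> \<exists>d>0. (D has_real_derivative d) (at y)"
  shows "D x < 0"
proof -
  \<comment> \<open>The strict increase up to an intermediate point survives the limit, which alone
    yields only a weak inequality.\<close>
  define y where "y = (x + b) / 2"
  have y: "x < y" "y < b" using \<open>x < b\<close> by (auto simp: y_def)
  have "D x < D y"
  proof (rule DERIV_pos_imp_increasing_open[of x y D])
    show "continuous_on {x..y} D"
      using cont by (rule continuous_on_subset) (use y in auto)
    show "\<exists>d. (D has_real_derivative d) (at t) \<and> 0 < d" if "x < t" "t < y" for t
      using deriv[of t] that y by force
  qed (use y in simp)
  also have "D y \<le> 0"
  proof (rule tendsto_0_at_left_nonpos[OF lim y(2)])
    show "continuous_on {y..<b} D"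
      using cont by (rule continuous_on_subset) (use y in auto)
    show "\<exists>d\<ge>0. (D has_real_derivative d) (at t)" if "y < t" "t < b" for t
      using deriv[of t] that y less_imp_le by fastforce
  qed
  finally show ?thesis .
qed

subsection \<open>Positive solutions\<close>

text \<open>Derivatives are required in the open interval only, and the conditions are invariant
  under x -> -x, so that results for the right half can be reflected.\<close>

locale p_laplace_bvp =
  fixes p :: real and f u u' :: "real \<Rightarrow> real"
  assumes p_gt_1: "p > 1"
    and f_cont: "continuous_on {0..} f"
    and u_cont: "continuous_on {-1..1} u"
    and u_ends: "u (-1) = 0" "u 1 = 0"
    and u_pos: "x \<in> {-1<..<1} \<Longrightarrow> u x > 0"
    and u_deriv: "x \<in> {-1<..<1} \<Longrightarrow> (u has_real_derivative u' x) (at x)"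
    and flux_deriv:
      "x \<in> {-1<..<1} \<Longrightarrow> ((\<lambda>y. phi p (u' y)) has_real_derivative - f (u x)) (at x)"
begin

text \<open>The conjugate exponent of \<open>p\<close>, for which |t|^p = |phi p t|^q.\<close>

definition q :: real where "q = p / (p - 1)"

lemma q_gt_1: "q > 1"
  using p_gt_1 by (simp add: q_def)

lemma u_nonneg: "x \<in> {-1..1} \<Longrightarrow> u x \<ge> 0"
  using u_pos[of x] u_ends by (cases "x = -1 \<or> x = 1") auto

lemma primitive_u_tendsto_0: "((\<lambda>x. primitive f (u x)) \<longlongrightarrow> 0) (at_left 1)"
proof -
  have "continuous_on {-1..1} (\<lambda>x. primitive f (u x))"
    using continuous_on_primitive[OF f_cont] u_cont
    by (rule continuous_on_compose2) (use u_nonneg in auto)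
  then have "((\<lambda>x. primitive f (u x)) \<longlongrightarrow> primitive f (u 1)) (at 1 within {-1..1})"
    by (simp add: continuous_on)
  then show ?thesis by (simp add: u_ends at_within_Icc_at_left)
qed

lemma u'_eq: "u' = (\<lambda>x. phi_inv p (phi p (u' x)))"
  using p_gt_1 by (simp add: phi_inv_phi)

lemma isCont_u':
  assumes "x \<in> {-1<..<1}"
  shows "isCont u' x"
proof -
  have "isCont (\<lambda>y. phi p (u' y)) x"
    using flux_deriv[OF assms] by (rule DERIV_isCont)
  moreover have "isCont (phi_inv p) (phi p (u' x))"
    using continuous_on_phi_inv[OF p_gt_1] by (simp add: continuous_on_eq_continuous_at)
  ultimately have "isCont (\<lambda>y. phi_inv p (phi p (u' y))) x"
    by (rule isCont_o2)
  then show ?thesis using u'_eq by simp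
qed

lemma u'_deriv:
  assumes "x \<in> {-1<..<1}" "u' x \<noteq> 0"
  shows "(u' has_real_derivative - f (u x) / phi_deriv p (u' x)) (at x)"
proof -
  have "((\<lambda>y. phi_inv p (phi p (u' y))) has_real_derivative
          inverse (phi_deriv p (u' x)) * (- f (u x))) (at x)"
    using has_real_derivative_phi_inv[OF p_gt_1 assms(2)] flux_deriv[OF assms(1)]
    by (rule DERIV_chain2)
  then show ?thesis using u'_eq by (simp add: field_simps)
qed

text \<open>In terms of the flux, |u'|^p is |phi p u'|^q, which is differentiable even at critical
  points of \<open>u\<close>, where \<open>u'\<close> need not be. Its derivative - q u' f(u)
  cancels that of \<open>q * primitive f (u x)\<close>.\<close>

lemma energy_conserved:
  assumes "x \<in> {-1<..<1}" "y \<in> {-1<..<1}"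
  shows "\<bar>u' x\<bar> powr p + q * primitive f (u x) = \<bar>u' y\<bar> powr p + q * primitive f (u y)"
proof -
  have eq: "\<bar>t\<bar> powr p = \<bar>phi p t\<bar> powr q" for t
    using p_gt_1 by (simp add: abs_phi powr_powr q_def)
  \<comment> \<open>The left side is \<open>phi_inv p (phi p t)\<close>, as q - 1 = 1 / (p -
    1).\<close>
  have u'_phi: "sgn (phi p t) * \<bar>phi p t\<bar> powr (q - 1) = t" for t
  proof -
    have "q - 1 = 1 / (p - 1)" using p_gt_1 by (simp add: q_def field_simps)
    then show ?thesis using phi_inv_phi[OF p_gt_1, of t] by (simp add: phi_inv_def)
  qed
  have "((\<lambda>x. \<bar>phi p (u' x)\<bar> powr q + q * primitive f (u x)) has_real_derivative 0) (at x)"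
    if x: "x \<in> {-1<..<1}" for x
  proof -
    have "((\<lambda>x. \<bar>phi p (u' x)\<bar> powr q) has_real_derivative q * u' x * (- f (u x))) (at x)"
      using DERIV_chain2[OF has_real_derivative_abs_powr[OF q_gt_1] flux_deriv[OF x]]
      by (simp add: u'_phi)
    from DERIV_add[OF this DERIV_cmult[OF
        DERIV_chain2[OF primitive_derivative[OF f_cont u_pos[OF x]] u_deriv[OF x]], of q]]
    show ?thesis by (simp add: algebra_simps)
  qed
  then show ?thesis
    unfolding eq using assms by (intro DERIV_isconst3[of "-1" 1]) auto
qed

end

subsection \<open>Shape of positive solutions\<close>

text \<open>The weighted square g^2 exp(c x) is nonincreasing for c = -2C and nondecreasing for c =
  2C, so the zero at \<open>a\<close> propagates in both directions.\<close>

lemma gronwall_zero: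
  fixes g g' :: "real \<Rightarrow> real"
  assumes g: "\<And>x. x \<in> {l<..<r} \<Longrightarrow> (g has_real_derivative g' x) (at x)"
    and bound: "\<And>x. x \<in> {l<..<r} \<Longrightarrow> \<bar>g' x\<bar> \<le> C * \<bar>g x\<bar>"
    and ab: "a \<in> {l<..<r}" "b \<in> {l<..<r}" and "g a = 0"
  shows "g b = 0"
proof -
  define H where "H c x = (g x)\<^sup>2 * exp (c * x)" for c x
  have H: "(H c has_real_derivative (2 * (g x * g' x) + c * (g x)\<^sup>2) * exp (c * x)) (at x)"
    if "x \<in> {l<..<r}" for x c
    unfolding H_def[abs_def] using g[OF that]
    by (auto intro!: derivative_eq_intros simp: algebra_simps)
  have prod: "\<bar>g x * g' x\<bar> \<le> C * (g x)\<^sup>2" if "x \<in> {l<..<r}" for x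
    using mult_left_mono[OF bound[OF that], of "\<bar>g x\<bar>"]
    by (simp add: abs_mult power2_eq_square algebra_simps)
  have "\<exists>c. H c b \<le> H c a"
  proof (cases "a \<le> b")
    case True
    have "H (- 2 * C) b \<le> H (- 2 * C) a"
    proof (rule DERIV_nonpos_imp_nonincreasing[OF True])
      fix x assume "a \<le> x" "x \<le> b"
      then have x: "x \<in> {l<..<r}" using ab by auto
      have "2 * (g x * g' x) + - 2 * C * (g x)\<^sup>2 \<le> 0"
        using prod[OF x] by (simp add: abs_le_iff)
      then show "\<exists>d. (H (- 2 * C) has_real_derivative d) (at x) \<and> d \<le> 0"
        using H[OF x] by (intro exI conjI) (auto intro: mult_nonpos_nonneg)
    qed
    then show ?thesis ..
  next
    case False
    then have "b \<le> a" by simp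
    have "H (2 * C) b \<le> H (2 * C) a"
    proof (rule DERIV_nonneg_imp_nondecreasing[OF \<open>b \<le> a\<close>])
      fix x assume "b \<le> x" "x \<le> a"
      then have x: "x \<in> {l<..<r}" using ab by auto
      have "0 \<le> 2 * (g x * g' x) + 2 * C * (g x)\<^sup>2"
        using prod[OF x] by (simp add: abs_le_iff)
      then show "\<exists>d. (H (2 * C) has_real_derivative d) (at x) \<and> d \<ge> 0"
        using H[OF x, of "2 * C"] by (metis exp_ge_zero mult_nonneg_nonneg)
    qed
    then show ?thesis ..
  qed
  then show ?thesis
    using \<open>g a = 0\<close> by (auto simp: H_def mult_le_0_iff)
qed

lemma nonzero_connected_neg:
  fixes g :: "real \<Rightarrow> real"
  assumes "connected S" "continuous_on S g" "\<And>x. x \<in> S \<Longrightarrow> g x \<noteq> 0"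
    and "y \<in> S" "g y < 0" "x \<in> S"
  shows "g x < 0"
proof (rule ccontr)
  assume "\<not> g x < 0"
  moreover have "connected (g ` S)"
    using connected_continuous_image[OF assms(2,1)] .
  ultimately have "0 \<in> g ` S"
    using connectedD_interval[of "g ` S" "g y" "g x" 0] assms(4-6) by simp
  then show False using assms(3) by auto
qed

context p_laplace_bvp
begin

lemma max_point:
  obtains x0 where "x0 \<in> {-1<..<1}" "\<And>x. x \<in> {-1..1} \<Longrightarrow> u x \<le> u x0"
proof -
  obtain x0 where x0: "x0 \<in> {-1..1}" "\<And>x. x \<in> {-1..1} \<Longrightarrow> u x \<le> u x0"
    using continuous_attains_sup[OF compact_Icc _ u_cont] by auto
  moreover have "u x0 > 0"
    using x0(2)[of 0] u_pos[of 0] by simp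
  ultimately show thesis
    using u_ends by (intro that[of x0]) (auto simp: less_le)
qed

lemma extremum_critical:
  assumes "x \<in> S" "open S" "S \<subseteq> {-1<..<1}"
    and "(\<forall>y\<in>S. u y \<le> u x) \<or> (\<forall>y\<in>S. u x \<le> u y)"
  shows "u' x = 0"
proof -
  obtain d where d: "d > 0" "\<forall>y. dist y x < d \<longrightarrow> y \<in> S"
    using assms(1,2) unfolding open_dist by blast
  then have near: "y \<in> S" if "\<bar>x - y\<bar> < d" for y
    using that by (simp add: dist_real_def abs_minus_commute)
  have deriv: "(u has_real_derivative u' x) (at x)"
    using assms(1,3) by (intro u_deriv) auto
  from assms(4) show ?thesis
  proof
    assume "\<forall>y\<in>S. u y \<le> u x"
    then show ?thesis using DERIV_local_max[OF deriv d(1)] near by simp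
  next
    assume "\<forall>y\<in>S. u x \<le> u y"
    then show ?thesis using DERIV_local_min[OF deriv d(1)] near by simp
  qed
qed

text \<open>At a rest point of level \<open>v\<close> the energy identity gives \<open>\<bar>u'\<bar>\<^sup>p = O(\<bar>u - v\<bar>\<^sup>2)\<close>, and for
  \<open>p \<le> 2\<close> this implies \<open>\<bar>u'\<bar> = O(\<bar>u - v\<bar>)\<close>.\<close>

lemma rest_point_constant:
  assumes p_le_2: "p \<le> 2"
    and f_deriv: "\<And>t. t \<ge> 0 \<Longrightarrow> (f has_real_derivative f' t) (at t within {0..})"
    and f'_cont: "continuous_on {0..} f'"
    and x: "x \<in> {-1<..<1}" "u' x = 0" "f (u x) = 0"
    and y: "y \<in> {-1<..<1}"
  shows "u y = u x"
proof -
  define v where "v = u x"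
  have v_pos: "v > 0" using u_pos x by (simp add: v_def)
  obtain x0 where x0: "x0 \<in> {-1<..<1}" "\<And>x. x \<in> {-1..1} \<Longrightarrow> u x \<le> u x0"
    using max_point by blast
  define M where "M = u x0"
  have M_pos: "M > 0" using u_pos x0 by (simp add: M_def)
  have u_in: "u s \<in> {0..M}" if "s \<in> {-1<..<1}" for s
    using u_pos[OF that] x0(2)[of s] that by (auto simp: M_def)
  have "compact (f' ` {0..M})"
    using f'_cont by (intro compact_continuous_image) (auto elim: continuous_on_subset)
  then obtain L where L: "L > 0" "\<And>s. s \<in> {0..M} \<Longrightarrow> \<bar>f' s\<bar> \<le> L"
    using compact_imp_bounded[of "f' ` {0..M}"] unfolding bounded_pos by auto
  \<comment> \<open>As \<open>f v = 0\<close>, the bound on \<open>f'\<close> makes \<open>f\<close>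
    at most linear in the distance from \<open>v\<close>; a second use of the mean value inequality
    makes \<open>F_bound\<close> quadratic.\<close>
  have f_bound: "\<bar>f s\<bar> \<le> L * \<bar>s - v\<bar>" if "s \<in> {0..M}" for s
  proof -
    have "norm (f s - f v) \<le> L * norm (s - v)"
      using that u_in[OF x(1)] L(2)
      by (intro field_differentiable_bound[of "{0..M}" f f'])
        (auto simp: v_def intro: DERIV_subset[OF f_deriv])
    then show ?thesis using x(3) by (simp add: v_def)
  qed
  have F_bound: "primitive f v - primitive f s \<le> L * \<bar>s - v\<bar>\<^sup>2" if "s \<in> {0..M}" for s
  proof -
    have seg: "closed_segment v s \<subseteq> {0..M}"
      using that u_in[OF x(1)] by (simp add: closed_segment_subset v_def)
    have "norm (primitive f v - primitive f s) \<le> L * \<bar>s - v\<bar> * norm (v - s)"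
    proof (rule field_differentiable_bound[of "closed_segment v s"])
      fix t assume t: "t \<in> closed_segment v s"
      show "(primitive f has_real_derivative f t) (at t within closed_segment v s)"
      proof (rule DERIV_subset[OF primitive_derivative_within[OF f_cont]])
        show "t \<ge> 0" "closed_segment v s \<subseteq> {0..}" using seg t by force+
      qed
      have "\<bar>f t\<bar> \<le> L * \<bar>t - v\<bar>" using f_bound seg t by auto
      also have "\<dots> \<le> L * \<bar>s - v\<bar>"
        using t L(1) by (intro mult_left_mono) (auto simp: closed_segment_eq_real_ivl split: if_splits)
      finally show "norm (f t) \<le> L * \<bar>s - v\<bar>" by simp
    qed auto
    then show ?thesis by (simp add: power2_eq_square abs_le_iff abs_minus_commute algebra_simps)
  qed
  \<comment> \<open>Chosen so that (C d)^p = q L M^(2-p) d^p, which dominates q L d^2 because d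
    \<le> M and p \<le> 2.\<close>
  define C where "C = (q * L * M powr (2 - p)) powr (1 / p)"
  have C: "C > 0" "C powr p = q * L * M powr (2 - p)"
    using q_gt_1 L(1) M_pos p_gt_1 by (auto simp: C_def powr_powr)
  have bound: "\<bar>u' s\<bar> \<le> C * \<bar>u s - v\<bar>" if s: "s \<in> {-1<..<1}" for s
  proof (rule ccontr)
    define d where "d = \<bar>u s - v\<bar>"
    assume "\<not> ?thesis"
    then have "C * d < \<bar>u' s\<bar>" by (simp add: d_def)
    then have "(C * d) powr p < \<bar>u' s\<bar> powr p"
      using C p_gt_1 by (intro powr_less_mono2) (auto simp: d_def)
    also have "\<bar>u' s\<bar> powr p = q * (primitive f v - primitive f (u s))"
      using energy_conserved[OF s x(1)] x(2) p_gt_1 by (simp add: v_def algebra_simps)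
    also have "\<dots> \<le> q * (L * d\<^sup>2)"
      using F_bound[OF u_in[OF s]] q_gt_1 by (intro mult_left_mono) (auto simp: d_def)
    also have "\<dots> \<le> (C * d) powr p"
    proof (cases "d = 0")
      case False
      then have d: "d > 0" "d \<le> M"
        using u_in[OF s] u_in[OF x(1)] by (auto simp: d_def v_def)
      have "d powr 2 = d powr (2 - p) * d powr p"
        by (simp flip: powr_add)
      also have "\<dots> \<le> M powr (2 - p) * d powr p"
        using d p_le_2 by (intro mult_right_mono powr_mono2) auto
      finally have "q * L * d powr 2 \<le> q * L * (M powr (2 - p) * d powr p)"
        using q_gt_1 L(1) by (intro mult_left_mono) auto
      then show ?thesis using d C by (simp add: powr_mult algebra_simps)
    qed simp
    finally show False by simp
  qed
  have "u y - v = 0"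
  proof (rule gronwall_zero[where g="\<lambda>s. u s - v" and g'=u' and a=x and l="-1" and r=1])
    show "((\<lambda>s. u s - v) has_real_derivative u' s) (at s)" if "s \<in> {-1<..<1}" for s
      using DERIV_diff[OF u_deriv[OF that] DERIV_const, of v] by simp
  qed (use bound x y in \<open>auto simp: v_def\<close>)
  then show ?thesis by (simp add: v_def)
qed

text \<open>Every level strictly between 0 and the maximum is attained. If \<open>u x\<close> were
  such a level, the energy identity would make \<open>primitive f\<close> maximal there, so
  \<open>f (u x) = 0\<close>, and \<open>no_rest\<close> would make \<open>u\<close>
  constant.\<close>

lemma critical_point_max:
  assumes x0: "x0 \<in> {-1<..<1}" "\<And>x. x \<in> {-1..1} \<Longrightarrow> u x \<le> u x0"
    and no_rest: "\<And>x y. x \<in> {-1<..<1} \<Longrightarrow> y \<in> {-1<..<1} \<Longrightarrow>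
      u' x = 0 \<Longrightarrow> f (u x) = 0 \<Longrightarrow> u y = u x"
    and x: "x \<in> {-1<..<1}" "u' x = 0"
  shows "u x = u x0"
proof (rule ccontr)
  assume ne: "u x \<noteq> u x0"
  define v where "v = u x"
  have v: "0 < v" "v < u x0"
    using u_pos[OF x(1)] x0(2)[of x] x ne by (auto simp: v_def)
  have "f v = 0"
  proof (rule DERIV_local_max[OF primitive_derivative[OF f_cont v(1)]])
    show "0 < min v (u x0 - v)" using v by simp
    show "\<forall>s. \<bar>v - s\<bar> < min v (u x0 - v) \<longrightarrow> primitive f s \<le> primitive f v"
    proof (intro allI impI)
      fix s assume "\<bar>v - s\<bar> < min v (u x0 - v)"
      then have s: "0 < s" "s < u x0" by auto
      have "continuous_on {-1..x0} u"
        using u_cont by (rule continuous_on_subset) (use x0 in auto)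
      then obtain y where y: "-1 \<le> y" "y \<le> x0" "u y = s"
        using IVT'[of u "-1" s x0] s u_ends x0(1) by auto
      then have "y \<in> {-1<..<1}"
        using x0(1) s u_ends by (cases "y = -1") auto
      from energy_conserved[OF this x(1)]
      have "q * primitive f s \<le> q * primitive f v"
        using x(2) y(3) p_gt_1 powr_ge_zero[of "\<bar>u' y\<bar>" p]
        unfolding v_def by (simp del: powr_ge_zero)
      then show "primitive f s \<le> primitive f v"
        using q_gt_1 by simp
    qed
  qed
  then show False
    using no_rest[OF x(1) x0(1) x(2)] ne by (simp add: v_def)
qed

text \<open>Between two critical points, both at the maximal level, the minimum of \<open>u\<close>
  is again at that level. So \<open>u\<close> is constant there, the flux vanishes, and the equation
  contradicts \<open>f_max\<close>.\<close>

lemma unique_critical_point: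
  assumes x0: "x0 \<in> {-1<..<1}" "\<And>x. x \<in> {-1..1} \<Longrightarrow> u x \<le> u x0"
    and no_rest: "\<And>x y. x \<in> {-1<..<1} \<Longrightarrow> y \<in> {-1<..<1} \<Longrightarrow>
      u' x = 0 \<Longrightarrow> f (u x) = 0 \<Longrightarrow> u y = u x"
    and f_max: "f (u x0) > 0"
    and x: "x \<in> {-1<..<1}" "u' x = 0"
  shows "x = x0"
proof (rule ccontr)
  assume "x \<noteq> x0"
  have level: "u y = u x0" if "y \<in> {-1<..<1}" "u' y = 0" for y
    by (rule critical_point_max[OF x0 _ that]) (use no_rest in blast)+
  define a b where "a = min x x0" and "b = max x x0"
  have ab: "-1 < a" "a < b" "b < 1" "u a = u x0" "u b = u x0"
    using \<open>x \<noteq> x0\<close> x x0 level[OF x] by (auto simp: a_def b_def min_def max_def)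
  have "continuous_on {a..b} u"
    using u_cont by (rule continuous_on_subset) (use ab in auto)
  then obtain c where c: "c \<in> {a..b}" "\<And>y. y \<in> {a..b} \<Longrightarrow> u c \<le> u y"
    using continuous_attains_inf[OF compact_Icc, of a b u] ab by auto
  have "u c = u x0"
  proof (cases "c = a \<or> c = b")
    case False
    then have "u' c = 0"
      using c ab by (intro extremum_critical[of c "{a<..<b}"]) auto
    then show ?thesis using level[of c] c ab by auto
  qed (use ab in auto)
  then have const: "u y = u x0" if "y \<in> {a..b}" for y
    using c(2)[OF that] x0(2)[of y] that ab by force
  have u'_0: "u' y = 0" if "y \<in> {a<..<b}" for y
    using that const ab by (intro extremum_critical[of y "{a<..<b}"]) auto
  define m where "m = (a + b) / 2"
  have m: "m \<in> {a<..<b}" using ab by (auto simp: m_def)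
  have "((\<lambda>y. 0) has_real_derivative - f (u m)) (at m)"
  proof (rule has_field_derivative_transform_within_open[OF flux_deriv])
    show "phi p (u' y) = 0" if "y \<in> {a<..<b}" for y
      using u'_0[OF that] by (simp add: phi_def)
  qed (use m ab in auto)
  then have "f (u m) = 0"
    using DERIV_unique[OF DERIV_const[of 0 "at m"]] by force
  then show False using const[of m] m f_max by simp
qed

text \<open>On each side of \<open>x0\<close> the mean value theorem gives one point with the right
  sign, and a continuous function without zeros on an interval keeps its sign.\<close>

lemma sign_of_derivative:
  assumes x0: "x0 \<in> {-1<..<1}"
    and crit: "\<And>x. x \<in> {-1<..<1} \<Longrightarrow> u' x = 0 \<Longrightarrow> x = x0"
  shows "x \<in> {x0<..<1} \<Longrightarrow> u' x < 0" and "x \<in> {-1<..<x0} \<Longrightarrow> u' x > 0"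
proof -
  have mvt: "\<exists>y\<in>{a<..<b}. u b - u a = (b - a) * u' y" if "-1 \<le> a" "a < b" "b \<le> 1" for a b
  proof -
    have "continuous_on {a..b} u"
      using u_cont by (rule continuous_on_subset) (use that in auto)
    moreover have "(u has_derivative (*) (u' t)) (at t)" if "a < t" "t < b" for t
      using u_deriv[of t] that \<open>-1 \<le> a\<close> \<open>b \<le> 1\<close> by (simp add: has_field_derivative_def)
    ultimately obtain y where "a < y" "y < b" "u b - u a = u' y * (b - a)"
      using mvt[OF \<open>a < b\<close>, of u "\<lambda>t. (*) (u' t)"] by blast
    then show ?thesis by (auto simp: mult.commute)
  qed
  have cont: "continuous_on S u'" if "S \<subseteq> {-1<..<1}" for S
    using that isCont_u' by (auto intro!: continuous_at_imp_continuous_on)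
  have M: "u x0 > 0" using u_pos[OF x0] .
  show "u' x < 0" if "x \<in> {x0<..<1}"
  proof -
    obtain y where y: "y \<in> {x0<..<1}" "u 1 - u x0 = (1 - x0) * u' y"
      using mvt[of x0 1] x0 by auto
    then have "(1 - x0) * u' y < 0" using u_ends M by simp
    then have "u' y < 0" using x0 by (simp add: mult_less_0_iff)
    show ?thesis
    proof (rule nonzero_connected_neg[of "{x0<..<1}" u', OF _ cont _ y(1) \<open>u' y < 0\<close> that])
      show "u' t \<noteq> 0" if "t \<in> {x0<..<1}" for t
        using crit[of t] that x0 by auto
    qed (use x0 in auto)
  qed
  show "u' x > 0" if "x \<in> {-1<..<x0}"
  proof -
    obtain y where y: "y \<in> {-1<..<x0}" "u x0 - u (-1) = (x0 - (-1)) * u' y"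
      using mvt[of "-1" x0] x0 by auto
    then have "(x0 - (-1)) * u' y > 0" using u_ends M by simp
    then have "- u' y < 0" using x0 by (simp add: zero_less_mult_iff)
    have "- u' x < 0"
    proof (rule nonzero_connected_neg[of "{-1<..<x0}" "\<lambda>x. - u' x", OF _ _ _ y(1) \<open>- u' y < 0\<close> that])
      show "- u' t \<noteq> 0" if "t \<in> {-1<..<x0}" for t
        using crit[of t] that x0 by auto
      show "continuous_on {-1<..<x0} (\<lambda>x. - u' x)"
        using x0 by (intro continuous_on_minus cont) auto
    qed auto
    then show ?thesis by simp
  qed
qed

text \<open>Otherwise the energy identity would force \<open>u'\<close> to 0 near 1. The mean value
  theorem, applied to difference quotients close to \<open>d\<close>, yields points near 1 where
  |u'| stays above - d / 2.\<close>

lemma energy_positive: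
  assumes d: "(u has_real_derivative d) (at 1 within {-1..1})" "d < 0"
    and x0: "x0 \<in> {-1<..<1}" "u' x0 = 0"
  shows "primitive f (u x0) > 0"
proof (rule ccontr)
  assume neg: "\<not> ?thesis"
  define e where "e = - d / 2"
  have e: "e > 0" using d by (simp add: e_def)
  have "((\<lambda>x. - q * primitive f (u x)) \<longlongrightarrow> - q * 0) (at_left 1)"
    by (intro tendsto_intros primitive_u_tendsto_0)
  then have "\<forall>\<^sub>F x in at_left 1. - q * primitive f (u x) < e powr p"
    using e by (intro order_tendstoD) auto
  moreover have "((\<lambda>x. (u x - u 1) / (x - 1)) \<longlongrightarrow> d) (at_left 1)"
    using d(1) by (simp add: has_field_derivative_iff at_within_Icc_at_left)
  then have "\<forall>\<^sub>F x in at_left 1. (u x - u 1) / (x - 1) < - e"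
    using d(2) by (intro order_tendstoD) (auto simp: e_def)
  ultimately have "\<forall>\<^sub>F x in at_left 1. - q * primitive f (u x) < e powr p
      \<and> (u x - u 1) / (x - 1) < - e"
    by (rule eventually_conj)
  then obtain b where b: "b < 1" and
    near: "\<And>x. b < x \<Longrightarrow> x < 1 \<Longrightarrow>
      - q * primitive f (u x) < e powr p \<and> (u x - u 1) / (x - 1) < - e"
    by (auto simp: eventually_at_left_field)
  \<comment> \<open>\<open>b\<close> may lie below -1; the maximum with 0 keeps \<open>s\<close> in
    the domain.\<close>
  define s where "s = max ((b + 1) / 2) 0"
  have s: "b < s" "s < 1" "-1 < s" using b by (auto simp: s_def max_def field_simps)
  have "continuous_on {s..1} u"
    using u_cont by (rule continuous_on_subset) (use s in auto)
  moreover have "(u has_derivative (*) (u' t)) (at t)" if "s < t" "t < 1" for t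
    using u_deriv[of t] that s by (simp add: has_field_derivative_def)
  ultimately obtain y where y: "s < y" "y < 1" "u 1 - u s = u' y * (1 - s)"
    using mvt[OF s(2), of u "\<lambda>t. (*) (u' t)"] by blast
  have "(u s - u 1) / (s - 1) = u' y"
    using y(3) s(2) by (simp add: field_simps)
  then have "e < \<bar>u' y\<bar>" using near[of s] s by auto
  then have "e powr p < \<bar>u' y\<bar> powr p"
    using e p_gt_1 by (intro powr_less_mono2) auto
  also have "\<bar>u' y\<bar> powr p = q * primitive f (u x0) - q * primitive f (u y)"
    using energy_conserved[of y x0] x0 y s p_gt_1 by simp
  also have "\<dots> \<le> - q * primitive f (u y)"
    using neg q_gt_1 by (simp add: mult_le_0_iff)
  finally show False using near[of y] y s by simp
qed

end

text \<open>The slope condition at 1 is replaced by \<open>energy_pos\<close>, which does not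
  distinguish the end points, so the assumptions are stable under reflection with
  \<open>- x0\<close> for \<open>x0\<close>.\<close>

locale single_bump = p_laplace_bvp +
  fixes \<gamma> x0 :: real
  assumes x0: "x0 \<in> {-1<..<1}"
    and u'_pos: "x \<in> {-1<..<x0} \<Longrightarrow> u' x > 0"
    and u'_neg: "x \<in> {x0<..<1} \<Longrightarrow> u' x < 0"
    and u'_x0: "u' x0 = 0"
    and u_x0: "u x0 > \<gamma>"
    and \<gamma>_pos: "\<gamma> > 0"
    and f_\<gamma>: "f \<gamma> = 0"
    and primitive_\<gamma>: "t \<in> {0<..<\<gamma>} \<Longrightarrow> primitive f \<gamma> < primitive f t"
    and energy_pos: "primitive f (u x0) > 0"
begin

lemma u'_nonzero: "x \<in> {-1<..<1} \<Longrightarrow> x \<noteq> x0 \<Longrightarrow> u' x \<noteq> 0"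
  using u'_pos[of x] u'_neg[of x] by force

lemma abs_u'_powr:
  "x \<in> {-1<..<1} \<Longrightarrow> \<bar>u' x\<bar> powr p = q * (primitive f (u x0) - primitive f (u x))"
  using energy_conserved[of x x0] x0 p_gt_1 by (simp add: u'_x0 algebra_simps)

lemma u_decreasing:
  assumes "x0 \<le> x" "x < y" "y \<le> 1"
  shows "u y < u x"
proof (rule DERIV_neg_imp_decreasing_open[OF assms(2)])
  show "\<exists>d. (u has_real_derivative d) (at t) \<and> d < 0" if "x < t" "t < y" for t
    using that assms x0 u_deriv[of t] u'_neg[of t] by force
  show "continuous_on {x..y} u"
    using u_cont by (rule continuous_on_subset) (use assms x0 in auto)
qed

text \<open>The energy identity expresses \<open>u'\<close> through \<open>primitive f (u x)\<close>
  to the right of \<open>x0\<close>, and \<open>energy_pos\<close> keeps the limit away from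
  0.\<close>

lemma u'_limit: "\<exists>L. L \<noteq> 0 \<and> (u' \<longlongrightarrow> L) (at_left 1)"
proof -
  have "((\<lambda>x. (q * (primitive f (u x0) - primitive f (u x))) powr (1 / p)) \<longlongrightarrow>
      (q * (primitive f (u x0) - 0)) powr (1 / p)) (at_left 1)"
    using q_gt_1 energy_pos by (intro tendsto_intros primitive_u_tendsto_0) auto
  then have "((\<lambda>x. - ((q * (primitive f (u x0) - primitive f (u x))) powr (1 / p))) \<longlongrightarrow>
      - ((q * primitive f (u x0)) powr (1 / p))) (at_left 1)"
    by (intro tendsto_minus) simp
  moreover have "\<forall>\<^sub>F x in at_left 1.
      - ((q * (primitive f (u x0) - primitive f (u x))) powr (1 / p)) = u' x"
  proof -
    have "- ((q * (primitive f (u x0) - primitive f (u x))) powr (1 / p)) = u' x"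
      if "x \<in> {x0<..<1}" for x
      using that x0 p_gt_1 u'_neg[OF that] by (simp flip: abs_u'_powr add: powr_powr)
    then show ?thesis
      using x0 by (auto simp: eventually_at_left_field)
  qed
  ultimately have "(u' \<longlongrightarrow> - ((q * primitive f (u x0)) powr (1 / p))) (at_left 1)"
    by (rule Lim_transform_eventually)
  then show ?thesis
    using q_gt_1 energy_pos by (intro exI conjI) auto
qed

lemma right_level_point:
  obtains \<xi> where "\<xi> \<in> {x0<..<1}" "u \<xi> = \<gamma>"
    "\<And>x. x \<in> {x0..<\<xi>} \<Longrightarrow> u x > \<gamma>"
    "\<And>x. x \<in> {\<xi><..<1} \<Longrightarrow> \<bar>u' x\<bar> < \<bar>u' \<xi>\<bar>"
proof -
  have "continuous_on {x0..1} u"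
    using u_cont by (rule continuous_on_subset) (use x0 in auto)
  then obtain \<xi> where \<xi>: "x0 \<le> \<xi>" "\<xi> \<le> 1" "u \<xi> = \<gamma>"
    using IVT2'[of u 1 \<gamma> x0] u_ends u_x0 \<gamma>_pos x0 by auto
  then have \<xi>_in: "\<xi> \<in> {x0<..<1}"
    using u_ends u_x0 \<gamma>_pos by (cases "\<xi> = x0"; cases "\<xi> = 1") auto
  show thesis
  proof
    show "u x > \<gamma>" if "x \<in> {x0..<\<xi>}" for x
      using u_decreasing[of x \<xi>] that \<xi> by simp
    show "\<bar>u' x\<bar> < \<bar>u' \<xi>\<bar>" if "x \<in> {\<xi><..<1}" for x
    proof -
      have "primitive f \<gamma> < primitive f (u x)"
        using u_decreasing[of \<xi> x] u_pos[of x] that \<xi> \<xi>_in x0 by (intro primitive_\<gamma>) auto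
      then have "\<bar>u' x\<bar> powr p < \<bar>u' \<xi>\<bar> powr p"
        using that \<xi> \<xi>_in x0 q_gt_1 by (simp add: abs_u'_powr)
      then show ?thesis
        using p_gt_1 powr_mono2[of p "\<bar>u' \<xi>\<bar>" "\<bar>u' x\<bar>"] by linarith
    qed
  qed (use \<xi> \<xi>_in in auto)
qed

end

subsection \<open>The linearized problem\<close>

text \<open>As \<open>x0\<close> is the only zero of \<open>u'\<close>, the exceptional set of the
  linearized problem is the single point \<open>x0\<close>, where \<open>w\<close> need not be
  differentiable.\<close>

locale linearization = single_bump +
  fixes f' w w' z :: "real \<Rightarrow> real"
  assumes f_deriv: "t > 0 \<Longrightarrow> (f has_real_derivative f' t) (at t)"
    and w_cont: "continuous_on {-1..1} w"
    and w_ends: "w (-1) = 0" "w 1 = 0"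
    and w_deriv: "x \<in> {-1<..<1} \<Longrightarrow> x \<noteq> x0 \<Longrightarrow> (w has_real_derivative w' x) (at x)"
    and z_eq: "x \<in> {-1<..<1} \<Longrightarrow> x \<noteq> x0 \<Longrightarrow> z x = phi_deriv p (u' x) * w' x"
    and z_deriv: "x \<in> {-1<..<1} \<Longrightarrow> (z has_real_derivative - (f' (u x) * w x)) (at x)"
begin

lemma f_u_deriv:
  "x \<in> {-1<..<1} \<Longrightarrow> ((\<lambda>x. f (u x)) has_real_derivative f' (u x) * u' x) (at x)"
  using DERIV_chain2[OF f_deriv[OF u_pos] u_deriv] .

lemma continuous_on_interior:
  assumes "S \<subseteq> {-1<..<1}"
  shows "continuous_on S w" "continuous_on S u" "continuous_on S u'" "continuous_on S z"
    "continuous_on S (\<lambda>x. f (u x))" "continuous_on S (\<lambda>x. phi p (u' x))"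
proof -
  show "continuous_on S w"
    using w_cont by (rule continuous_on_subset) (use assms in force)
  show "continuous_on S u"
    using u_cont by (rule continuous_on_subset) (use assms in force)
  show "continuous_on S u'" "continuous_on S z"
    "continuous_on S (\<lambda>x. f (u x))" "continuous_on S (\<lambda>x. phi p (u' x))"
    using assms isCont_u' DERIV_isCont[OF z_deriv] DERIV_isCont[OF f_u_deriv]
      DERIV_isCont[OF flux_deriv]
    by (auto intro!: continuous_at_imp_continuous_on)
qed

text \<open>The Wronskian of \<^term>\<open>w\<close> and \<^term>\<open>u'\<close>, evaluated at \<^term>\<open>x0\<close> where \<^term>\<open>u'\<close> vanishes.\<close>

definition k :: real where "k = w x0 * f (u x0)"

text \<open>The derivative cancels away from \<open>x0\<close>; the two halves are joined by
  continuity, since \<open>w\<close> and \<open>u'\<close> may fail to be differentiable at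
  \<open>x0\<close>.\<close>

lemma wronskian_const:
  assumes "x \<in> {-1<..<1}"
  shows "w x * f (u x) + u' x * z x = k"
proof -
  define W where "W x = w x * f (u x) + u' x * z x" for x
  have W_deriv: "(W has_real_derivative 0) (at x)" if x: "x \<in> {-1<..<1}" "x \<noteq> x0" for x
  proof -
    have "phi_deriv p (u' x) \<noteq> 0"
      using phi_deriv_pos[OF p_gt_1 u'_nonzero[OF x]] by simp
    then show ?thesis
      unfolding W_def[abs_def]
      using w_deriv[OF x] f_u_deriv[OF x(1)] u'_deriv[OF x(1) u'_nonzero[OF x]] z_deriv[OF x(1)]
      by (auto intro!: derivative_eq_intros simp: z_eq[OF x] field_simps)
  qed
  have cont: "continuous_on S W" if "S \<subseteq> {-1<..<1}" for S
    unfolding W_def[abs_def] using continuous_on_interior[OF that] by (intro continuous_intros)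
  have "W x = W x0"
  proof (cases x x0 rule: linorder_cases)
    case less
    have "W x0 = W x"
      using less assms x0 by (intro DERIV_isconst_end cont W_deriv) auto
    then show ?thesis ..
  next
    case greater
    show ?thesis
      using greater assms x0 by (intro DERIV_isconst_end cont W_deriv) auto
  qed simp
  then show ?thesis by (simp add: W_def k_def u'_x0)
qed

text \<open>Reduction of order with the known solution \<open>u'\<close>: multiplied by
  \<open>phi_deriv p (u' x)\<close>, the numerator of the quotient rule is the Wronskian.\<close>

lemma quotient_deriv:
  assumes x: "x \<in> {-1<..<1}" "x \<noteq> x0"
  shows "((\<lambda>x. w x / u' x) has_real_derivative k / ((p - 1) * \<bar>u' x\<bar> powr p)) (at x)"
proof -
  have pd: "phi_deriv p (u' x) \<noteq> 0"
    using phi_deriv_pos[OF p_gt_1 u'_nonzero[OF x]] by simp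
  have "((\<lambda>x. w x / u' x) has_real_derivative
      (w' x * u' x - w x * (- f (u x) / phi_deriv p (u' x))) / (u' x * u' x)) (at x)"
    using w_deriv[OF x] u'_deriv[OF x(1) u'_nonzero[OF x]] u'_nonzero[OF x]
    by (rule DERIV_divide)
  moreover have "(w' x * u' x - w x * (- f (u x) / phi_deriv p (u' x))) / (u' x * u' x)
      = k / (phi_deriv p (u' x) * (u' x)\<^sup>2)"
    using pd u'_nonzero[OF x] wronskian_const[OF x(1)] z_eq[OF x]
    by (simp add: field_simps power2_eq_square)
  ultimately show ?thesis by (simp add: phi_deriv_mult_square)
qed

section \<open>The sign of \<open>w\<close> to the right of the maximum\<close>

lemma w_tendsto_0: "(w \<longlongrightarrow> 0) (at_left 1)"
proof -
  have "(w \<longlongrightarrow> w 1) (at 1 within {-1..1})"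
    using w_cont by (simp add: continuous_on)
  then show ?thesis by (simp add: w_ends at_within_Icc_at_left)
qed

lemma u_tendsto_0: "(u \<longlongrightarrow> 0) (at_left 1)"
proof -
  have "(u \<longlongrightarrow> u 1) (at 1 within {-1..1})"
    using u_cont by (simp add: continuous_on)
  then show ?thesis by (simp add: u_ends at_within_Icc_at_left)
qed

lemma quotient_tendsto_0: "((\<lambda>x. w x / u' x) \<longlongrightarrow> 0) (at_left 1)"
proof -
  obtain L where "L \<noteq> 0" "(u' \<longlongrightarrow> L) (at_left 1)"
    using u'_limit by blast
  then show ?thesis
    using tendsto_divide[OF w_tendsto_0, of u' L] by simp
qed

lemma quotient_cont:
  assumes "x \<in> {x0<..<1}"
  shows "continuous_on {x..<1} (\<lambda>x. w x / u' x)"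
proof (rule continuous_on_divide)
  show "continuous_on {x..<1} w" "continuous_on {x..<1} u'"
    by (rule continuous_on_interior, use assms x0 in auto)+
  show "\<forall>y\<in>{x..<1}. u' y \<noteq> 0"
  proof
    fix y assume "y \<in> {x..<1}"
    then show "u' y \<noteq> 0" using u'_neg[of y] assms by auto
  qed
qed

text \<open>The quotient \<open>w / u'\<close> increases strictly to its limit 0 at 1, hence is
  negative, and \<open>u'\<close> is negative too.\<close>

lemma w_pos_right:
  assumes "k > 0" and x: "x \<in> {x0<..<1}"
  shows "w x > 0"
proof -
  have "w x / u' x < 0"
  proof (rule tendsto_0_at_left_neg[OF quotient_tendsto_0 _ quotient_cont[OF x]])
    show "\<exists>d>0. ((\<lambda>x. w x / u' x) has_real_derivative d) (at y)" if "x < y" "y < 1" for y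
    proof (intro exI conjI)
      show "((\<lambda>x. w x / u' x) has_real_derivative k / ((p - 1) * \<bar>u' y\<bar> powr p)) (at y)"
        using that x x0 by (intro quotient_deriv) auto
      show "k / ((p - 1) * \<bar>u' y\<bar> powr p) > 0"
        using that x p_gt_1 assms(1) u'_neg[of y] by auto
    qed
  qed (use x in auto)
  then show ?thesis using u'_neg[OF x] by (simp add: divide_less_0_iff)
qed

text \<open>The weak inequality suffices, as it is applied to both \<open>w\<close> and
  \<open>- w\<close>.\<close>

lemma w_nonneg_right:
  assumes "k = 0" and x: "x \<in> {x0<..<1}"
  shows "w x \<ge> 0"
proof -
  have "w x / u' x \<le> 0"
  proof (rule tendsto_0_at_left_nonpos[OF quotient_tendsto_0 _ quotient_cont[OF x]])
    show "\<exists>d\<ge>0. ((\<lambda>x. w x / u' x) has_real_derivative d) (at y)" if "x < y" "y < 1" for y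
      using quotient_deriv[of y] that x x0 assms(1) by (intro exI[of _ 0]) auto
  qed (use x in auto)
  then show ?thesis using u'_neg[OF x] by (simp add: divide_le_0_iff)
qed

text \<open>The Wronskian of \<^term>\<open>w\<close> and \<^term>\<open>u\<close>, using \<open>\<phi>'(u') u' = (p - 1) \<phi>(u')\<close>.\<close>

definition T :: "real \<Rightarrow> real" where
  "T x = u x * z x - (p - 1) * phi p (u' x) * w x"

text \<open>The terms containing \<open>w'\<close> cancel. By the growth condition on
  \<open>f\<close>, the remainder has the sign of \<open>- w\<close> where \<open>u\<close> exceeds
  \<gamma>.\<close>

lemma T_deriv:
  assumes x: "x \<in> {-1<..<1}" "x \<noteq> x0"
  shows "(T has_real_derivative - ((f' (u x) * u x - (p - 1) * f (u x)) * w x)) (at x)"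
proof -
  have "u' x * z x = (p - 1) * phi p (u' x) * w' x"
    unfolding z_eq[OF x] phi_deriv_mult_self[symmetric] by simp
  then show ?thesis
    unfolding T_def[abs_def]
    using u_deriv[OF x(1)] z_deriv[OF x(1)] flux_deriv[OF x(1)] w_deriv[OF x]
    by (auto intro!: derivative_eq_intros simp: algebra_simps)
qed

lemma T_cont: "S \<subseteq> {-1<..<1} \<Longrightarrow> continuous_on S T"
  unfolding T_def[abs_def] by (intro continuous_intros continuous_on_interior)

text \<open>As \<open>f \<gamma> = 0\<close>, the Wronskian determines \<open>z\<close> at \<xi>,
  and the claim becomes a lower bound for \<open>w \<xi>\<close>. It holds because
  \<open>w / u' + C * u\<close> increases to 0 at 1 and so is negative at \<xi>.\<close>

lemma T_right:
  assumes "k > 0"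
  obtains \<xi> where "\<xi> \<in> {x0<..<1}" "T \<xi> > 0" "\<And>x. x \<in> {x0..<\<xi>} \<Longrightarrow> u x > \<gamma>"
proof -
  obtain \<xi> where \<xi>: "\<xi> \<in> {x0<..<1}" "u \<xi> = \<gamma>"
    "\<And>x. x \<in> {x0..<\<xi>} \<Longrightarrow> u x > \<gamma>"
    and slope: "\<And>x. x \<in> {\<xi><..<1} \<Longrightarrow> \<bar>u' x\<bar> < \<bar>u' \<xi>\<bar>"
    using right_level_point by blast
  define c where "c = - u' \<xi>"
  have c: "c > 0" using u'_neg[OF \<xi>(1)] by (simp add: c_def)
  define C where "C = k / ((p - 1) * (c powr p * c))"
  \<comment> \<open>\<^term>\<open>C\<close> is chosen so that the derivative of \<open>w / u' + C u\<close>, namely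
      \<open>k / (p - 1) * (\<bar>u'\<bar>\<^sup>-\<^sup>p - \<bar>u'\<bar> c\<^sup>-\<^sup>p\<^sup>-\<^sup>1)\<close>, is positive where \<open>\<bar>u'\<bar> < c\<close>.\<close>
  have "w \<xi> / u' \<xi> + C * u \<xi> < 0"
  proof (rule tendsto_0_at_left_neg[where D="\<lambda>x. w x / u' x + C * u x" and b=1])
    show "((\<lambda>x. w x / u' x + C * u x) \<longlongrightarrow> 0) (at_left 1)"
      using tendsto_add[OF quotient_tendsto_0 tendsto_mult[OF tendsto_const u_tendsto_0]] by simp
    show "continuous_on {\<xi>..<1} (\<lambda>x. w x / u' x + C * u x)"
      using \<xi>(1) x0 by (intro continuous_intros quotient_cont continuous_on_interior(2)) auto
    show "\<exists>d>0. ((\<lambda>x. w x / u' x + C * u x) has_real_derivative d) (at x)"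
      if "\<xi> < x" "x < 1" for x
    proof (intro exI conjI)
      have x: "x \<in> {-1<..<1}" "x \<noteq> x0" using that \<xi>(1) x0 by auto
      show "((\<lambda>x. w x / u' x + C * u x) has_real_derivative
          k / ((p - 1) * \<bar>u' x\<bar> powr p) + C * u' x) (at x)"
        using quotient_deriv[OF x] DERIV_cmult[OF u_deriv[OF x(1)]] by (rule DERIV_add)
      define a where "a = - u' x"
      have a: "0 < a" "a < c"
        using u'_neg[of x] that \<xi>(1) slope[of x] u'_neg[OF \<xi>(1)] by (auto simp: a_def c_def)
      have "a powr p * a < c powr p * c"
        using a p_gt_1 by (intro mult_strict_mono powr_less_mono2) auto
      then have "a / (c powr p * c) < 1 / a powr p"
        using a by (simp add: field_simps)
      then have "k / (p - 1) * (a / (c powr p * c)) < k / (p - 1) * (1 / a powr p)"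
        using assms p_gt_1 by (intro mult_strict_left_mono) auto
      moreover have "C * u' x = - (k / (p - 1) * (a / (c powr p * c)))"
        by (simp add: C_def a_def)
      moreover have "\<bar>u' x\<bar> = a" using a by (simp add: a_def)
      ultimately show "k / ((p - 1) * \<bar>u' x\<bar> powr p) + C * u' x > 0"
        by simp
    qed
  qed (use \<xi> in auto)
  then have w_\<xi>: "w \<xi> > C * \<gamma> * c"
    using c \<xi>(2) by (simp add: c_def field_simps)
  have "phi p (u' \<xi>) = - (c powr (p - 1))"
    using abs_phi[of p "u' \<xi>"] sgn_phi[of p "u' \<xi>"] c 
    by (auto simp: c_def sgn_if split: if_splits)
  moreover have "u' \<xi> * z \<xi> = k"
    using wronskian_const[of \<xi>] \<xi> f_\<gamma> x0 by simp
  then have "z \<xi> = - (k / c)"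
    using c by (auto simp: c_def field_simps)
  ultimately have "T \<xi> = (p - 1) * c powr (p - 1) * w \<xi> - \<gamma> * k / c"
    by (simp add: T_def \<xi>(2))
  \<comment> \<open>With this \<open>C\<close>, the lower bound for \<open>w \<xi>\<close> produces
    exactly the term subtracted in \<open>T \<xi>\<close>.\<close>
  moreover have "(p - 1) * c powr (p - 1) * (C * \<gamma> * c) = \<gamma> * k / c"
    using c p_gt_1 by (simp add: C_def powr_diff field_simps)
  moreover have "(p - 1) * c powr (p - 1) * (C * \<gamma> * c) < (p - 1) * c powr (p - 1) * w \<xi>"
    using w_\<xi> c p_gt_1 by (intro mult_strict_left_mono) auto
  ultimately have "T \<xi> > 0" by simp
  with \<xi> show thesis by (intro that) auto
qed

section \<open>Symmetries of the linearized problem and vanishing of \<open>k\<close>\<close>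

lemma linearization_uminus:
  "linearization p f u u' \<gamma> x0 f' (\<lambda>x. - w x) (\<lambda>x. - w' x) (\<lambda>x. - z x)"
  by unfold_locales
    (auto intro!: continuous_intros derivative_eq_intros w_cont w_deriv z_deriv f_deriv
      simp: w_ends z_eq)

text \<open>Reflection leaves \<open>k\<close> unchanged and turns \<open>T x\<close> into
  \<open>- T (- x)\<close>, so \<open>T_right\<close> also gives a left level point, where
  \<open>T\<close> is negative.\<close>

lemma reflected_linearization:
  "linearization p f (\<lambda>x. u (- x)) (\<lambda>x. - u' (- x)) \<gamma> (- x0) f'
     (\<lambda>x. w (- x)) (\<lambda>x. - w' (- x)) (\<lambda>x. - z (- x))"
proof unfold_locales
  have refl: "((\<lambda>x. g (- x)) has_real_derivative - d) (at x)"
    if "(g has_real_derivative d) (at (- x))" for g :: "real \<Rightarrow> real" and d x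
    using DERIV_chain2[where f=g and g=uminus and Db="- 1", OF that]
    by (simp add: DERIV_minus[OF DERIV_ident])
  show "continuous_on {-1..1} (\<lambda>x. u (- x))" "continuous_on {-1..1} (\<lambda>x. w (- x))"
    using u_cont w_cont by (auto intro!: continuous_on_compose2[of _ _ _ uminus] continuous_intros)
  show "((\<lambda>x. u (- x)) has_real_derivative - u' (- x)) (at x)" if "x \<in> {-1<..<1}" for x
    using that by (intro refl u_deriv) auto
  show "((\<lambda>y. phi p (- u' (- y))) has_real_derivative - f (u (- x))) (at x)"
    if "x \<in> {-1<..<1}" for x
    using DERIV_minus[OF refl[OF flux_deriv[of "- x"]]] that by (simp add: phi_minus)
  show "((\<lambda>x. w (- x)) has_real_derivative - w' (- x)) (at x)"
    if "x \<in> {-1<..<1}" "x \<noteq> - x0" for x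
    using that by (intro refl w_deriv) auto
  show "((\<lambda>x. - z (- x)) has_real_derivative - (f' (u (- x)) * w (- x))) (at x)"
    if "x \<in> {-1<..<1}" for x
    using DERIV_minus[OF refl[OF z_deriv[of "- x"]]] that by simp
qed (use p_gt_1 f_cont u_ends u_pos x0 u'_pos u'_neg u'_x0 u_x0 \<gamma>_pos f_\<gamma> primitive_\<gamma>
      energy_pos f_deriv w_ends z_eq in \<open>auto simp: phi_deriv_minus\<close>)

lemma k_nonpos:
  assumes conv: "\<And>t. t > \<gamma> \<Longrightarrow> f' t > (p - 1) * (f t / t)" and f_max: "f (u x0) > 0"
  shows "k \<le> 0"
proof (rule ccontr)
  assume "\<not> ?thesis"
  then have k: "k > 0" by simp
  interpret R: linearization p f "\<lambda>x. u (- x)" "\<lambda>x. - u' (- x)" \<gamma> "- x0" f'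
    "\<lambda>x. w (- x)" "\<lambda>x. - w' (- x)" "\<lambda>x. - z (- x)"
    by (rule reflected_linearization)
  have "R.k > 0" using k by (simp add: R.k_def k_def)
  \<comment> \<open>\<open>T_deriv\<close> excludes \<open>x0\<close>, so the strip between the two
    level points is treated in two halves that meet at \<open>x0\<close>.\<close>
  have T_decreasing: "T b < T a"
    if ab: "-1 < a" "a < b" "b < 1" and w_pos: "\<And>x. x \<in> {a<..<b} \<Longrightarrow> w x > 0"
      and u_gt: "\<And>x. x \<in> {a<..<b} \<Longrightarrow> u x > \<gamma>" and ne: "x0 \<notin> {a<..<b}" for a b
  proof (rule DERIV_neg_imp_decreasing_open[OF ab(2)])
    fix x assume "a < x" "x < b"
    then have x: "x \<in> {a<..<b}" by simp
    have "f' (u x) > (p - 1) * (f (u x) / u x)" "u x > 0"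
      using conv u_gt[OF x] \<gamma>_pos by force+
    then have "f' (u x) * u x - (p - 1) * f (u x) > 0"
      by (simp add: field_simps)
    then have "- ((f' (u x) * u x - (p - 1) * f (u x)) * w x) < 0"
      using w_pos[OF x] by simp
    moreover have "x \<noteq> x0" "x \<in> {-1<..<1}" using x ne ab by auto
    ultimately show "\<exists>d. (T has_real_derivative d) (at x) \<and> d < 0"
      using T_deriv by blast
  qed (use ab in \<open>auto intro: T_cont\<close>)
  obtain \<xi> where \<xi>: "\<xi> \<in> {x0<..<1}" "T \<xi> > 0" "\<And>x. x \<in> {x0..<\<xi>} \<Longrightarrow> u x > \<gamma>"
    using T_right[OF k] by blast
  obtain \<eta> where \<eta>: "\<eta> \<in> {- x0<..<1}" "R.T \<eta> > 0" "\<And>x. x \<in> {- x0..<\<eta>} \<Longrightarrow> u (- x) > \<gamma>"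
    using R.T_right[OF \<open>R.k > 0\<close>] by blast
  have "T \<xi> < T x0"
    using \<xi> x0 w_pos_right[OF k] by (intro T_decreasing) auto
  also have "T x0 < T (- \<eta>)"
  proof (rule T_decreasing)
    show "w x > 0" if "x \<in> {- \<eta><..<x0}" for x
      using R.w_pos_right[OF \<open>R.k > 0\<close>, of "- x"] that \<eta>(1) by simp
    show "u x > \<gamma>" if "x \<in> {- \<eta><..<x0}" for x
      using \<eta>(3)[of "- x"] that by simp
  qed (use \<eta> x0 in auto)
  also have "T (- \<eta>) = - R.T \<eta>"
    by (simp add: R.T_def T_def phi_minus)
  finally show False using \<xi>(2) \<eta>(2) by simp
qed

text \<open>\<open>k_nonpos\<close> for \<open>w\<close> and \<open>- w\<close> gives
  \<open>k = 0\<close>. Then \<open>w\<close> vanishes at \<open>x0\<close> because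
  \<open>f (u x0)\<close> is positive, and on each half because \<open>w\<close> and
  \<open>- w\<close> are both nonnegative.\<close>

lemma w_eq_0:
  assumes conv: "\<And>t. t > \<gamma> \<Longrightarrow> f' t > (p - 1) * (f t / t)" and f_max: "f (u x0) > 0"
    and x: "x \<in> {-1..1}"
  shows "w x = 0"
proof -
  interpret N: linearization p f u u' \<gamma> x0 f' "\<lambda>x. - w x" "\<lambda>x. - w' x" "\<lambda>x. - z x"
    by (rule linearization_uminus)
  interpret R: linearization p f "\<lambda>x. u (- x)" "\<lambda>x. - u' (- x)" \<gamma> "- x0" f'
    "\<lambda>x. w (- x)" "\<lambda>x. - w' (- x)" "\<lambda>x. - z (- x)"
    by (rule reflected_linearization)
  interpret NR: linearization p f "\<lambda>x. u (- x)" "\<lambda>x. - u' (- x)" \<gamma> "- x0" f'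
    "\<lambda>x. - w (- x)" "\<lambda>x. - (- w' (- x))" "\<lambda>x. - (- z (- x))"
    by (rule R.linearization_uminus)
  have k: "k = 0"
    using k_nonpos[OF conv f_max] N.k_nonpos[OF conv f_max] by (simp add: k_def N.k_def)
  then have k': "N.k = 0" "R.k = 0" "NR.k = 0"
    by (simp_all add: k_def N.k_def R.k_def NR.k_def)
  consider "x = -1" | "x = 1" | "x = x0" | "x \<in> {x0<..<1}" | "- x \<in> {- x0<..<1}"
    using x by force
  then show ?thesis
  proof cases
    case 3
    then show ?thesis using k f_max by (simp add: k_def)
  next
    case 4
    then show ?thesis
      using w_nonneg_right[OF k] N.w_nonneg_right[OF k'(1)] by force
  next
    case 5
    then show ?thesis
      using R.w_nonneg_right[OF k'(2) 5] NR.w_nonneg_right[OF k'(3) 5] by simp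
  qed (simp_all add: w_ends)
qed

end

theorem theorem1:
  fixes p \<gamma> :: real and f f' u u' :: "real \<Rightarrow> real"
  assumes "p > 1"
    and f_deriv: "\<And>t. t \<ge> 0 \<Longrightarrow> (f has_real_derivative f' t) (at t within {0..})"
    and f_C1: "continuous_on {0..} f'"
    and "\<gamma> > 0"
    and "f \<gamma> = 0"
    and "\<And>t. t > \<gamma> \<Longrightarrow> f t > 0"
    and "\<And>t. t > \<gamma> \<Longrightarrow> f' t > (p - 1) * (f t / t)"
    and "\<And>t. 0 < t \<Longrightarrow> t < \<gamma> \<Longrightarrow> integral {t..\<gamma>} f < 0"
    and "positive_solution p f u u'"
    and "u 0 > \<gamma>"
    and "u' 1 < 0"
    and no_rest_point: "p > 2 \<Longrightarrow> \<forall>x\<in>{-1<..<1}. u' x = 0 \<longrightarrow> f (u x) \<noteq> 0"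
  shows "non_singular p f' u u'"
proof -
  note f_pos = assms(6) and conv = assms(7) and int_neg = assms(8)
  have u_within: "(u has_real_derivative u' x) (at x within {-1..1})" if "x \<in> {-1..1}" for x
    using assms(9) that by (simp add: positive_solution_def)
  have f_cont: "continuous_on {0..} f"
    using f_deriv by (intro DERIV_continuous_on) auto
  interpret p_laplace_bvp p f u u'
  proof unfold_locales
    show "continuous_on {-1..1} u"
      using u_within by (rule DERIV_continuous_on)
    show "(u has_real_derivative u' x) (at x)" if "x \<in> {-1<..<1}" for x
    proof -
      have "at x within {-1..1} = at x"
        using that by (intro at_within_interior) auto
      then show ?thesis using u_within[of x] that by simp
    qed
  qed (use assms(1,9) f_cont in \<open>auto simp: positive_solution_def\<close>)
  obtain x0 where x0: "x0 \<in> {-1<..<1}" "\<And>x. x \<in> {-1..1} \<Longrightarrow> u x \<le> u x0"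
    using max_point by blast
  have u_x0: "u x0 > \<gamma>" using x0(2)[of 0] \<open>u 0 > \<gamma>\<close> by simp
  have u'_x0: "u' x0 = 0"
    using x0 by (intro extremum_critical[of x0 "{-1<..<1}"]) auto
  \<comment> \<open>For p \<le> 2 rest points force \<open>u\<close> to be constant; for p > 2 the
    hypothesis rules them out.\<close>
  have no_rest: "u y = u x"
    if "x \<in> {-1<..<1}" "y \<in> {-1<..<1}" "u' x = 0" "f (u x) = 0" for x y
  proof (cases "p \<le> 2")
    case True
    then show ?thesis
      using rest_point_constant[OF True f_deriv f_C1 that(1,3,4,2)] by simp
  next
    case False
    then show ?thesis using no_rest_point that by simp
  qed
  have crit: "x = x0" if "x \<in> {-1<..<1}" "u' x = 0" for x
    using unique_critical_point[OF x0 no_rest f_pos[OF u_x0]] that by blast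
  interpret single_bump p f u u' \<gamma> x0
  proof unfold_locales
    show "primitive f \<gamma> < primitive f t" if "t \<in> {0<..<\<gamma>}" for t
      using int_neg[of t] integral_eq_primitive_diff[OF f_cont, of t \<gamma>] that by simp
    \<comment> \<open>This is where the condition \<open>u' 1 < 0\<close> enters.\<close>
    show "primitive f (u x0) > 0"
      using energy_positive[OF u_within \<open>u' 1 < 0\<close> x0(1) u'_x0] by simp
  qed (use sign_of_derivative[OF x0(1) crit] x0(1) u'_x0 u_x0 \<open>\<gamma> > 0\<close> \<open>f \<gamma> = 0\<close> in auto)
  show ?thesis
    unfolding non_singular_def
  proof (intro allI impI ballI)
    fix w :: "real \<Rightarrow> real" and x :: real
    assume lin: "linearized_solution p f' u u' w" and x: "x \<in> {-1..1}"
    then obtain w' z where wz: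
      "\<And>x. x \<in> {-1<..<1} \<Longrightarrow> u' x \<noteq> 0 \<Longrightarrow>
         (w has_real_derivative w' x) (at x) \<and> z x = phi_deriv p (u' x) * w' x"
      "\<And>x. x \<in> {-1<..<1} \<Longrightarrow> (z has_real_derivative - (f' (u x) * w x)) (at x)"
      unfolding linearized_solution_def by blast
    interpret linearization p f u u' \<gamma> x0 f' w w' z
    proof unfold_locales
      show "(f has_real_derivative f' t) (at t)" if "t > 0" for t
      proof -
        have "at t within {0..} = at t"
          using that by (intro at_within_interior) auto
        then show ?thesis using f_deriv[of t] that by simp
      qed
    qed (use lin wz u'_nonzero in \<open>auto simp: linearized_solution_def\<close>)
    show "w x = 0"
      using w_eq_0[OF conv f_pos[OF u_x0] x] .
  qed
qed

end
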